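(* Let $p \neq 0$. The equation $$u_t - u_{txx} = \tfrac{1}{2}(p+1)(p+2)u^p u_x - \tfrac{1}{2}p(p-1)u^{p-2}u_x^3 - 2p\,u^{p-1}u_x u_{xx} - u^p u_{xxx}$$ for $u(t,x)$ admits the peaked travelling waves $$u = c^{1/p}\exp(-|x+ct|), \quad p\neq 0,$$ which are weak solutions, where $c$ is an arbitrary nonzero constant (subject to the restriction on the sign of $c$ given in the context).
   Context: The parameter $p\neq 0$ is an arbitrary nonlinearity power. A travelling wave $u=U(z)$, $z=x+ct$, with $c$ a non-zero constant, reduces the partial differential equation in the claim to the ordinary differential equation $$0=\Big(\tfrac{1}{2}pU^{p-1}(U^2-U'^2)+(-c+U^p)(U-U'')\Big)'.$$ Multiplying this by a test function $\psi$ (smooth with compact support), integrating over $-\infty<z<\infty$ and integrating by parts, with $\phi=\psi'$, gives the integral equation $$0=\int_{-\infty}^{+\infty}\Big(-c(\phi U+\phi' U') + \tfrac{1}{2}p\,\phi\, U^{p-1}(U^2-U'^2) + \phi\, U^{p+1} + U'(\phi\, U^p)'\Big)\,dz.$$ Weak solutions (for travelling waves) are functions $U(z)$ that belong to the Sobolev space $W^{1,p+1}_{\mathrm{loc}}(\mathbb{R})$ and satisfy this integral equation for all smooth test functions $\phi(z)$ with compact support. The peaked travelling wave corresponds to $U(z)=c^{1/p}\exp(-|z|)$. Restriction on the sign of $c$: when $p$ is an odd integer, or more generally when $p$ is rational with an odd denominator, there is no restriction on the sign of $c$; in all other cases $c$ must be positive.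
   Formalization: The statement additionally assumes that c^{1/p} is a real number; this excludes only negative c when p is a fraction with even numerator and odd denominator (e.g. p = 2, c = -1), where c^{1/p} is undefined over the reals. *)

theory Defs
  imports "HOL-Analysis.Analysis"
begin

section \<open>Real powers of possibly negative numbers\<close>

definition odd_denominator :: "real \<Rightarrow> bool" where
  "odd_denominator r \<longleftrightarrow> (\<exists>m n :: int. odd n \<and> r = of_int m / of_int n)"

text \<open>
  The set on which the real power is meaningful as a real number. It is needed explicitly because
  \<^term>\<open>(powr)\<close> (and hence the function below) is total.
\<close>

definition rpow_defined :: "real \<Rightarrow> real \<Rightarrow> bool" where
  "rpow_defined x r \<longleftrightarrow> 0 < x \<or> (x = 0 \<and> 0 \<le> r) \<or> (x < 0 \<and> odd_denominator r)"

text \<open>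
  For \<open>x < 0\<close> and \<open>r = m / n\<close> with \<open>n\<close> odd this is the \<open>m\<close>-th power of the real \<open>n\<close>-th root of \<open>x\<close>;
  see the lemma \<open>rpow_eq_root_powi\<close> below. The value has no meaning where
  \<^const>\<open>rpow_defined\<close> fails.
\<close>

definition rpow :: "real \<Rightarrow> real \<Rightarrow> real" where
  "rpow x r =
     (if r = 0 then 1
      else if x < 0 \<and> (\<exists>m n :: int. odd m \<and> odd n \<and> r = of_int m / of_int n)
      then - (\<bar>x\<bar> powr r) else \<bar>x\<bar> powr r)"

lemma odd_quotient_iff:
  fixes m n :: int
  assumes "odd n"
  shows "(\<exists>m' n' :: int. odd m' \<and> odd n' \<and> (of_int m / of_int n :: real) = of_int m' / of_int n')
           \<longleftrightarrow> odd m"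
proof
  assume "\<exists>m' n' :: int. odd m' \<and> odd n' \<and> (of_int m / of_int n :: real) = of_int m' / of_int n'"
  then obtain m' n' :: int where *: "odd m'" "odd n'" "(of_int m / of_int n :: real) = of_int m' / of_int n'"
    by blast
  have "n \<noteq> 0" "n' \<noteq> 0" using assms * by auto
  with *(3) have "(of_int (m * n') :: real) = of_int (m' * n)"
    by (simp add: field_simps)
  then have "m * n' = m' * n" by linarith
  with * assms show "odd m" by (metis even_mult_iff)
qed (use assms in blast)

lemma rpow_eq_root_powi:
  fixes m :: int
  assumes "x < 0" "odd n"
  shows "rpow x (of_int m / of_nat n) = root n x powi m"
proof -
  have n: "n > 0" using assms by (cases n) auto
  define y where "y = \<bar>x\<bar> powr (1 / n)"
  have y: "y > 0" using assms by (simp add: y_def)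
  have "root n x = - root n \<bar>x\<bar>"
    using assms by (simp add: real_root_minus)
  also have "root n \<bar>x\<bar> = y"
    using assms n by (simp add: y_def root_powr_inverse)
  finally have root: "root n x = - y" .
  have pow: "y powi m = \<bar>x\<bar> powr (of_int m / of_nat n)"
    using y by (simp add: y_def powr_powr flip: powr_real_of_int')
  have "odd (int n)" using assms by simp
  from odd_quotient_iff[OF this, of m] show ?thesis
    using assms n pow by (cases "even m") (auto simp: rpow_def root power_int_minus_left)
qed

lemma has_real_derivative_rpow:
  assumes "x \<noteq> 0" "rpow_defined x r"
  shows "((\<lambda>x. rpow x r) has_real_derivative r * rpow x (r - 1)) (at x)"
proof (cases "r = 0")
  case True
  then show ?thesis by (simp add: rpow_def)
next
  case r: False
  show ?thesis
  proof (cases "x > 0")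
    case True
    have "((\<lambda>x. x powr r) has_real_derivative r * x powr (r - 1)) (at x)"
      using True by (auto intro!: derivative_eq_intros)
    then have "((\<lambda>x. rpow x r) has_real_derivative r * x powr (r - 1)) (at x)"
      by (rule DERIV_cong_ev[THEN iffD1, rotated -1])
         (use True r in \<open>auto simp: rpow_def intro!: eventually_mono[OF eventually_gt_at_top]
            eventually_nhds_in_open[of "{0<..}", THEN eventually_mono]\<close>)
    then show ?thesis using True by (auto simp: rpow_def)
  next
    case False
    then have x: "x < 0" using assms by simp
    obtain m n :: int where mn: "odd n" "r = of_int m / of_int n"
      using assms x by (auto simp: rpow_defined_def odd_denominator_def)
    define s :: real where "s = (if odd m then -1 else 1)"
    have r1: "r - 1 = of_int (m - n) / of_int n"
      using mn by (cases "n = 0") (auto simp: field_simps)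
    have s: "rpow y r = s * (- y) powr r" if "y < 0" for y
      using that mn odd_quotient_iff[OF mn(1), of m] r by (auto simp: rpow_def s_def)
    have s1: "rpow x (r - 1) = - s * (- x) powr (r - 1)"
    proof (cases "r = 1")
      case True
      then have "(of_int m :: real) = of_int n" using mn by (cases "n = 0") auto
      then have "m = n" by linarith
      then show ?thesis using True x mn by (simp add: rpow_def s_def)
    next
      case False
      then show ?thesis
        using x mn(1) odd_quotient_iff[OF mn(1), of "m - n"] unfolding r1[symmetric]
        by (auto simp: rpow_def s_def)
    qed
    have "((\<lambda>x. s * (- x) powr r) has_real_derivative s * (r * (- x) powr (r - 1) * -1)) (at x)"
      using x by (auto intro!: derivative_eq_intros)
    then have "((\<lambda>x. rpow x r) has_real_derivative s * (r * (- x) powr (r - 1) * -1)) (at x)"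
      by (rule DERIV_cong_ev[THEN iffD1, rotated -1])
         (use x s in \<open>auto intro!: eventually_nhds_in_open[of "{..<0}", THEN eventually_mono]\<close>)
    then show ?thesis by (simp add: s1 mult_ac)
  qed
qed

lemma no_real_root_if_not_rpow_defined:
  assumes "c \<noteq> 0" "\<not> rpow_defined c (1 / p)" "p \<noteq> 0"
  shows "\<nexists>a. rpow_defined a p \<and> rpow a p = c"
proof
  assume "\<exists>a. rpow_defined a p \<and> rpow a p = c"
  then obtain a where a: "rpow_defined a p" "rpow a p = c" by blast
  have c: "c < 0" using assms by (auto simp: rpow_defined_def)
  have "rpow a p \<ge> 0" if "\<not> (\<exists>m n :: int. odd m \<and> odd n \<and> p = of_int m / of_int n)"
    using that by (auto simp: rpow_def)
  with c a obtain m n :: int where "odd m" "odd n" "p = of_int m / of_int n" by force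
  then have "odd m" "1 / p = of_int n / of_int m" by auto
  then have "odd_denominator (1 / p)" unfolding odd_denominator_def by blast
  with c assms show False by (auto simp: rpow_defined_def)
qed


section \<open>Test functions, weak derivatives, Sobolev spaces\<close>

definition smooth :: "(real \<Rightarrow> real) \<Rightarrow> bool" where
  "smooth f \<longleftrightarrow> (\<forall>n x. (deriv ^^ n) f field_differentiable at x)"

definition test_function :: "(real \<Rightarrow> real) \<Rightarrow> bool" where
  "test_function f \<longleftrightarrow> smooth f \<and> compact (closure {x. f x \<noteq> 0})"

definition locally_integrable :: "(real \<Rightarrow> real) \<Rightarrow> bool" where
  "locally_integrable f \<longleftrightarrow> (\<forall>K. compact K \<longrightarrow> f absolutely_integrable_on K)"

definition weak_derivative :: "(real \<Rightarrow> real) \<Rightarrow> (real \<Rightarrow> real) \<Rightarrow> bool" where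
  "weak_derivative f g \<longleftrightarrow> locally_integrable f \<and> locally_integrable g \<and>
     (\<forall>\<phi>. test_function \<phi> \<longrightarrow>
        (LINT x|lebesgue. f x * deriv \<phi> x) = - (LINT x|lebesgue. g x * \<phi> x))"

text \<open>
  The exponent \<open>q\<close> is an arbitrary real number: it will be instantiated by \<open>p + 1\<close>. For \<open>q \<ge> 1\<close>
  these are the usual local Lebesgue and Sobolev spaces. For other \<open>q\<close> the same integral condition
  is used; the middle clause below accounts for the convention \<open>0 powr q = 0\<close>, which would otherwise
  make a negative power integrable across zeros of \<open>f\<close>.
\<close>

definition Lq_loc :: "real \<Rightarrow> (real \<Rightarrow> real) set" where
  "Lq_loc q = {f. f \<in> borel_measurable lebesgue \<and> (q < 0 \<longrightarrow> (AE x in lebesgue. f x \<noteq> 0)) \<and>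
                  locally_integrable (\<lambda>x. \<bar>f x\<bar> powr q)}"

definition W1q_loc :: "real \<Rightarrow> (real \<Rightarrow> real) set" where
  "W1q_loc q = {f. f \<in> Lq_loc q \<and> (\<exists>g. weak_derivative f g \<and> g \<in> Lq_loc q)}"


section \<open>The equation and its travelling waves\<close>

definition dt :: "(real \<Rightarrow> real \<Rightarrow> real) \<Rightarrow> real \<Rightarrow> real \<Rightarrow> real" where
  "dt u = (\<lambda>t x. deriv (\<lambda>s. u s x) t)"

definition dx :: "(real \<Rightarrow> real \<Rightarrow> real) \<Rightarrow> real \<Rightarrow> real \<Rightarrow> real" where
  "dx u = (\<lambda>t x. deriv (\<lambda>y. u t y) x)"

definition peakon_equation :: "real \<Rightarrow> (real \<Rightarrow> real \<Rightarrow> real) \<Rightarrow> bool" where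
  "peakon_equation p u \<longleftrightarrow> (\<forall>t x.
     dt u t x - dx (dx (dt u)) t x =
       1/2 * (p + 1) * (p + 2) * rpow (u t x) p * dx u t x
       - 1/2 * p * (p - 1) * rpow (u t x) (p - 2) * (dx u t x) ^ 3
       - 2 * p * rpow (u t x) (p - 1) * dx u t x * dx (dx u) t x
       - rpow (u t x) p * dx (dx (dx u)) t x)"

text \<open>
  With \<open>u(t, x) = U(x + c t)\<close> the equation becomes \<open>F' = 0\<close>, where \<open>F\<close> is the following function
  of \<open>U\<close>, \<open>U'\<close>, \<open>U''\<close>.
\<close>

definition travelling_wave_flux :: "real \<Rightarrow> real \<Rightarrow> real \<Rightarrow> real \<Rightarrow> real \<Rightarrow> real" where
  "travelling_wave_flux p c U U1 U2 =
     1/2 * p * rpow U (p - 1) * (U\<^sup>2 - U1\<^sup>2) + (- c + rpow U p) * (U - U2)"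

text \<open>
  The integrand of the weak form: \<open>U1\<close> stands for \<open>U'\<close> and \<open>D\<close> for the derivative of \<open>\<phi> U\<^sup>p\<close>.
\<close>

definition weak_integrand ::
  "real \<Rightarrow> real \<Rightarrow> (real \<Rightarrow> real) \<Rightarrow> (real \<Rightarrow> real) \<Rightarrow> (real \<Rightarrow> real) \<Rightarrow> (real \<Rightarrow> real) \<Rightarrow> real \<Rightarrow> real"
where
  "weak_integrand p c \<phi> U U1 D = (\<lambda>z.
     - c * (\<phi> z * U z + deriv \<phi> z * U1 z)
     + 1/2 * p * \<phi> z * rpow (U z) (p - 1) * ((U z)\<^sup>2 - (U1 z)\<^sup>2)
     + \<phi> z * rpow (U z) (p + 1)
     + U1 z * D z)"

text \<open>
  The first clause says that the powers of \<open>U\<close> in the integral equation (with exponents \<open>p - 1\<close>,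
  \<open>p\<close> and \<open>p + 1\<close>) are meaningful real numbers; definedness for \<open>p - 1\<close> implies it for the others.
\<close>

definition weak_profile :: "real \<Rightarrow> real \<Rightarrow> (real \<Rightarrow> real) \<Rightarrow> bool" where
  "weak_profile p c U \<longleftrightarrow>
     (AE z in lebesgue. rpow_defined (U z) (p - 1)) \<and>
     U \<in> W1q_loc (p + 1) \<and>
     (\<exists>U1. weak_derivative U U1 \<and>
        (\<forall>\<phi>. test_function \<phi> \<longrightarrow>
           (\<exists>D. weak_derivative (\<lambda>z. \<phi> z * rpow (U z) p) D \<and>
              integrable lebesgue (weak_integrand p c \<phi> U U1 D) \<and>
              (LINT z|lebesgue. weak_integrand p c \<phi> U U1 D z) = 0)))"

text \<open>
  Weak travelling wave solutions, with wave speed parameter \<open>c\<close>, of \<^const>\<open>peakon_equation\<close>.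
\<close>

definition weak_travelling_wave_solution :: "real \<Rightarrow> real \<Rightarrow> (real \<Rightarrow> real \<Rightarrow> real) \<Rightarrow> bool" where
  "weak_travelling_wave_solution p c u \<longleftrightarrow>
     (\<exists>U. u = (\<lambda>t x. U (x + c * t)) \<and> weak_profile p c U)"


section \<open>How the weak form arises from the equation\<close>

lemma rpow_defined_diff_one:
  assumes "x \<noteq> 0" "rpow_defined x r"
  shows "rpow_defined x (r - 1)"
proof -
  have "odd_denominator (r - 1)" if "odd_denominator r"
  proof -
    from that obtain m n :: int where mn: "odd n" "r = of_int m / of_int n"
      by (auto simp: odd_denominator_def)
    then have "r - 1 = of_int (m - n) / of_int n" by (cases "n = 0") (auto simp: field_simps)
    with mn show ?thesis unfolding odd_denominator_def by blast
  qed
  with assms show ?thesis by (auto simp: rpow_defined_def)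
qed

lemma rpow_plus_one:
  assumes "x \<noteq> 0" "rpow_defined x (r + 1)"
  shows "rpow x (r + 1) = x * rpow x r"
proof (cases "x > 0")
  case True
  have "x * x powr r = x powr (r + 1)" using True by (simp add: powr_add)
  then show ?thesis using True by (auto simp: rpow_def)
next
  case False
  then have x: "x < 0" using assms by simp
  then obtain m n :: int where mn: "odd n" "r + 1 = of_int m / of_int n"
    using assms by (auto simp: rpow_defined_def odd_denominator_def)
  define k where "k = nat \<bar>n\<bar>"
  define l where "l = sgn n * m"
  have k: "odd k" "r + 1 = of_int l / of_nat k"
    using mn by (auto simp: k_def l_def even_nat_iff sgn_if)
  then have r: "r = of_int (l - int k) / of_nat k"
    by (cases "k = 0") (auto simp: field_simps)
  have "root k x ^ k = x" "root k x \<noteq> 0"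
    using x k by (auto simp: odd_real_root_pow odd_pos)
  moreover have "rpow x (r + 1) = root k x powi l"
    unfolding k(2) using x k(1) by (rule rpow_eq_root_powi)
  moreover have "rpow x r = root k x powi (l - int k)"
    unfolding r using x k(1) by (rule rpow_eq_root_powi)
  ultimately show ?thesis using assms(1) by (simp add: power_int_diff)
qed

lemma flux_derivative_algebra:
  fixes p c u u1 u2 u3 a :: real
  shows "1/2 * p * ((p - 1) * a * u1 * (u\<^sup>2 - u1\<^sup>2) + (u * a) * (2 * u * u1 - 2 * u1 * u2))
      + p * (u * a) * u1 * (u - u2) + (- c + u * (u * a)) * (u1 - u3) =
    1/2 * (p + 1) * (p + 2) * (u * (u * a)) * u1 - 1/2 * p * (p - 1) * a * u1 ^ 3
      - 2 * p * (u * a) * u1 * u2 - u * (u * a) * u3 - (c * u1 - c * u3)"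
proof -
  define h where "h = p / 2"
  have p: "p = 2 * h" by (simp add: h_def)
  show ?thesis unfolding p by (simp add: algebra_simps power2_eq_square power3_eq_cube)
qed

context
  fixes p c :: real and U U1 U2 U3 :: "real \<Rightarrow> real"
  assumes U1: "\<And>z. (U has_real_derivative U1 z) (at z)"
    and U2: "\<And>z. (U1 has_real_derivative U2 z) (at z)"
    and U3: "\<And>z. (U2 has_real_derivative U3 z) (at z)"
    and nz: "\<And>z. U z \<noteq> 0"
    and pow: "\<And>z. rpow_defined (U z) p"
begin

lemma travelling_wave_reduction:
  "peakon_equation p (\<lambda>t x. U (x + c * t)) \<longleftrightarrow>
     (\<forall>z. ((\<lambda>z. travelling_wave_flux p c (U z) (U1 z) (U2 z)) has_real_derivative 0) (at z))"
proof -
  have shiftx: "deriv (\<lambda>y. f (y + c * t)) x = f' (x + c * t)"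
    if "\<And>z. (f has_real_derivative f' z) (at z)" for f f' t x
    using that[of "x + c * t"] by (intro DERIV_imp_deriv) (simp add: DERIV_shift)
  have shiftt: "deriv (\<lambda>s. U (x + c * s)) t = c * U1 (x + c * t)" for t x
  proof (rule DERIV_imp_deriv)
    have "((\<lambda>s. x + c * s) has_real_derivative c) (at t)"
      by (auto intro!: derivative_eq_intros)
    from DERIV_chain2[OF U1 this]
    show "((\<lambda>s. U (x + c * s)) has_real_derivative c * U1 (x + c * t)) (at t)"
      by (simp add: mult.commute)
  qed
  note dxs = shiftx[OF U1] shiftx[OF U2] shiftx[OF U3]
  have cU2: "\<And>z. ((\<lambda>z. c * U1 z) has_real_derivative c * U2 z) (at z)"
    and cU3: "\<And>z. ((\<lambda>z. c * U2 z) has_real_derivative c * U3 z) (at z)"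
    using U2 U3 by (auto intro!: derivative_eq_intros)
  note dtx = shiftx[OF cU2] shiftx[OF cU3]
  define R where "R z = 1/2 * p * ((p - 1) * rpow (U z) (p - 2) * U1 z * ((U z)\<^sup>2 - (U1 z)\<^sup>2)
      + rpow (U z) (p - 1) * (2 * U z * U1 z - 2 * U1 z * U2 z))
      + p * rpow (U z) (p - 1) * U1 z * (U z - U2 z) + (- c + rpow (U z) p) * (U1 z - U3 z)" for z
  have d: "((\<lambda>z. rpow (U z) p) has_real_derivative p * rpow (U z) (p - 1) * U1 z) (at z)"
    "((\<lambda>z. rpow (U z) (p - 1)) has_real_derivative (p - 1) * rpow (U z) (p - 2) * U1 z) (at z)" for z
    using DERIV_chain2[OF has_real_derivative_rpow[OF nz pow] U1]
      DERIV_chain2[OF has_real_derivative_rpow[OF nz rpow_defined_diff_one[OF nz pow]] U1]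
    by (simp_all add: mult_ac)
  have flux: "((\<lambda>z. travelling_wave_flux p c (U z) (U1 z) (U2 z)) has_real_derivative R z) (at z)" for z
    unfolding travelling_wave_flux_def R_def
    by (rule derivative_eq_intros d U1 U2 U3 refl)+ (simp add: field_simps)
  have e1: "rpow (U z) p = U z * rpow (U z) (p - 1)" for z
    using rpow_plus_one[OF nz, of z "p - 1"] pow by simp
  have e2: "rpow (U z) (p - 1) = U z * rpow (U z) (p - 2)" for z
    using rpow_plus_one[OF nz, of z "p - 2"] rpow_defined_diff_one[OF nz pow] by simp
  have alg: "R z = 1/2 * (p + 1) * (p + 2) * rpow (U z) p * U1 z
       - 1/2 * p * (p - 1) * rpow (U z) (p - 2) * (U1 z) ^ 3
       - 2 * p * rpow (U z) (p - 1) * U1 z * U2 z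
       - rpow (U z) p * U3 z - (c * U1 z - c * U3 z)" for z
    unfolding R_def e1 e2 by (rule flux_derivative_algebra)
  have "peakon_equation p (\<lambda>t x. U (x + c * t)) \<longleftrightarrow> (\<forall>t x. R (x + c * t) = 0)"
    unfolding peakon_equation_def dt_def dx_def shiftt dxs dtx alg right_minus_eq
    by (intro iff_allI eq_commute)
  also have "\<dots> \<longleftrightarrow> (\<forall>z. R z = 0)"
    by (metis add.right_neutral mult_zero_right)
  also have "\<dots> \<longleftrightarrow> (\<forall>z. ((\<lambda>z. travelling_wave_flux p c (U z) (U1 z) (U2 z)) has_real_derivative 0) (at z))"
    using flux DERIV_unique by metis
  finally show ?thesis .
qed

lemma travelling_wave_weak_form:
  assumes "peakon_equation p (\<lambda>t x. U (x + c * t))" "test_function \<psi>"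
  shows "(weak_integrand p c (deriv \<psi>) U U1 (deriv (\<lambda>z. deriv \<psi> z * rpow (U z) p)) has_integral 0) UNIV"
proof -
  define F where "F z = travelling_wave_flux p c (U z) (U1 z) (U2 z)" for z
  have F: "(F has_real_derivative 0) (at z)" for z
    using assms(1) unfolding travelling_wave_reduction F_def by blast
  have sm: "smooth \<psi>" and cp: "compact (closure {x. \<psi> x \<noteq> 0})"
    using assms by (auto simp: test_function_def)
  have d1: "(\<psi> has_real_derivative deriv \<psi> z) (at z)" for z
    using sm[unfolded smooth_def, rule_format, of 0 z]
    by (simp add: DERIV_deriv_iff_field_differentiable)
  have d2: "(deriv \<psi> has_real_derivative deriv (deriv \<psi>) z) (at z)" for z
    using sm[unfolded smooth_def, rule_format, of 1 z]
    by (simp add: DERIV_deriv_iff_field_differentiable)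
  have dU: "((\<lambda>z. rpow (U z) p) has_real_derivative p * rpow (U z) (p - 1) * U1 z) (at z)" for z
    using DERIV_chain2[OF has_real_derivative_rpow[OF nz pow] U1] .
  have dD: "deriv (\<lambda>z. deriv \<psi> z * rpow (U z) p) z =
      deriv \<psi> z * (p * rpow (U z) (p - 1) * U1 z) + deriv (deriv \<psi>) z * rpow (U z) p" for z
    by (rule DERIV_imp_deriv) (rule derivative_eq_intros d2 dU refl | simp)+
  have e1: "rpow (U z) (p + 1) = U z * rpow (U z) p" if "rpow_defined (U z) (p + 1)" for z
    using rpow_plus_one[OF nz that] .
  have def1: "rpow_defined (U z) (p + 1)" for z
  proof -
    have "odd_denominator (p + 1)" if "odd_denominator p"
    proof -
      from that obtain m n :: int where mn: "odd n" "p = of_int m / of_int n"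
        by (auto simp: odd_denominator_def)
      then have "p + 1 = of_int (m + n) / of_int n" by (cases "n = 0") (auto simp: field_simps)
      with mn show ?thesis unfolding odd_denominator_def by blast
    qed
    then show ?thesis using pow[of z] nz[of z] by (auto simp: rpow_defined_def)
  qed
  define G where "G z = \<psi> z * F z + deriv \<psi> z * (rpow (U z) p - c) * U1 z" for z
  have G: "(G has_real_derivative
      weak_integrand p c (deriv \<psi>) U U1 (deriv (\<lambda>z. deriv \<psi> z * rpow (U z) p)) z) (at z)" for z
    unfolding G_def
    by (rule derivative_eq_intros d1 d2 dU F U1 U2 refl)+
       (simp add: weak_integrand_def dD e1[OF def1] F_def travelling_wave_flux_def,
        simp add: field_simps)
  obtain B where B: "B > 0" "closure {x. \<psi> x \<noteq> 0} \<subseteq> ball 0 B"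
    using cp compact_imp_bounded bounded_subset_ballD by metis
  have out: "\<psi> z = 0" "deriv \<psi> z = 0" "deriv (deriv \<psi>) z = 0" if "z \<notin> ball 0 B" for z
  proof -
    define S where "S = - closure {x. \<psi> x \<noteq> 0}"
    have S: "open S" "z \<in> S" using that B by (auto simp: S_def)
    have 0: "\<psi> y = 0" if "y \<in> S" for y
      using that closure_subset[of "{x. \<psi> x \<noteq> 0}"] by (auto simp: S_def)
    have 1: "deriv \<psi> y = 0" if "y \<in> S" for y
      by (rule DERIV_imp_deriv, rule has_field_derivative_transform_within_open[of "\<lambda>_. 0" _ _ S])
         (use that 0 S in auto)
    have 2: "deriv (deriv \<psi>) y = 0" if "y \<in> S" for y
      by (rule DERIV_imp_deriv, rule has_field_derivative_transform_within_open[of "\<lambda>_. 0" _ _ S])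
         (use that 1 S in auto)
    from 0 1 2 S show "\<psi> z = 0" "deriv \<psi> z = 0" "deriv (deriv \<psi>) z = 0" by auto
  qed
  have "(weak_integrand p c (deriv \<psi>) U U1 (deriv (\<lambda>z. deriv \<psi> z * rpow (U z) p)) has_integral (G B - G (-B))) {-B..B}"
    by (rule fundamental_theorem_of_calculus)
       (use B G in \<open>auto simp flip: has_real_derivative_iff_has_vector_derivative
          intro: has_field_derivative_at_within\<close>)
  moreover have "G B = 0" "G (-B) = 0"
    using B by (auto simp: G_def out)
  ultimately have "(weak_integrand p c (deriv \<psi>) U U1 (deriv (\<lambda>z. deriv \<psi> z * rpow (U z) p)) has_integral 0) {-B..B}"
    by simp
  then show ?thesis
    by (rule has_integral_on_superset) (auto simp: weak_integrand_def dD out)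
qed

end

end

theory Submission
  imports Defs
begin

text \<open>
  Let \<open>a\<^sup>p = c\<close>, \<open>U z = a exp (- |z|)\<close> and \<open>U' = - s U\<close>, where \<open>s = \<plusminus>1\<close> is the sign of \<open>z\<close>.
  Then \<open>U\<^sup>p = c exp (- p |z|)\<close> and \<open>(U')\<^sup>2 = U\<^sup>2\<close>, so off the peak the integrand of the weak form is
  the derivative of \<open>G = \<phi> U s (c - U\<^sup>p)\<close>. Since \<open>U\<^sup>p = c\<close> at the peak, \<open>G\<close> is continuous across
  it, and as it has compact support the integral vanishes.
\<close>

section \<open>Smooth functions and test functions\<close>

lemma smoothD:
  assumes "smooth f"
  shows "(f has_real_derivative deriv f x) (at x)"
  using assms[unfolded smooth_def, rule_format, of 0 x]
  by (simp add: DERIV_deriv_iff_field_differentiable)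

lemma smooth_deriv:
  assumes "smooth f"
  shows "smooth (deriv f)"
  using assms[unfolded smooth_def, rule_format, of "Suc _"] by (simp add: smooth_def funpow_swap1)

lemma smooth_continuous_on: "smooth f \<Longrightarrow> continuous_on S f"
  by (meson DERIV_isCont continuous_at_imp_continuous_on smoothD)

lemma deriv_eq_0_outside_support:
  fixes f :: "real \<Rightarrow> real"
  assumes "x \<notin> closure {x. f x \<noteq> 0}"
  shows "deriv f x = 0"
proof (rule DERIV_imp_deriv, rule has_field_derivative_transform_within_open)
  show "((\<lambda>_. 0) has_real_derivative 0) (at x)" by simp
  show "0 = f y" if "y \<in> - closure {x. f x \<noteq> 0}" for y
    using that closure_subset[of "{x. f x \<noteq> 0}"] by auto
qed (use assms in auto)

lemma test_function_deriv:
  assumes "test_function f"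
  shows "test_function (deriv f)"
proof -
  have "closure {x. deriv f x \<noteq> 0} \<subseteq> closure {x. f x \<noteq> 0}"
    by (rule closure_minimal) (use deriv_eq_0_outside_support[of _ f] in auto)
  moreover have "compact (closure {x. f x \<noteq> 0})" "smooth f"
    using assms by (simp_all add: test_function_def)
  ultimately show ?thesis
    using compact_Int_closed[of "closure {x. f x \<noteq> 0}" "closure {x. deriv f x \<noteq> 0}"]
    by (simp add: test_function_def smooth_deriv inf.absorb2)
qed

section \<open>Compact support and local integrability\<close>

text \<open>The fundamental theorem of calculus on a large interval leaves only boundary terms,
  which vanish. Continuity of \<open>F\<close> across \<open>S\<close> excludes jump terms. This
  serves both integration by parts for weak derivatives and the weak equation itself.\<close>

lemma has_integral_derivative_compact_support:
  fixes F f :: "real \<Rightarrow> real"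
  assumes "finite S" "continuous_on UNIV F"
    and "\<And>x. x \<notin> S \<Longrightarrow> (F has_real_derivative f x) (at x)"
    and "bounded K" "\<And>x. x \<notin> K \<Longrightarrow> F x = 0" "\<And>x. x \<notin> K \<Longrightarrow> f x = 0"
  shows "(f has_integral 0) UNIV"
proof -
  obtain B where B: "B > 0" "K \<subseteq> ball 0 B"
    using assms(4) bounded_subset_ballD by metis
  have "(f has_integral F B - F (- B)) {- B..B}"
    by (rule fundamental_theorem_of_calculus_interior_strong[of S])
       (use assms B in \<open>auto simp flip: has_real_derivative_iff_has_vector_derivative
          intro: continuous_on_subset\<close>)
  \<comment> \<open>\<open>K\<close> lies in the open ball of radius \<open>B\<close>, so the
    endpoints lie outside \<open>K\<close>.\<close>
  moreover have "F B = 0" "F (- B) = 0"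
    using B by (auto intro!: assms(5))
  ultimately have "(f has_integral 0) {- B..B}" by simp
  then show ?thesis
    by (rule has_integral_on_superset) (use B in \<open>auto intro!: assms(6) simp: subset_iff\<close>)
qed

text \<open>Meant for functions such as \<open>U'\<close> that jump at the peak: Borel measurability
  and a continuous bound, integrable on every compact set, replace continuity.\<close>

lemma locally_integrable_dominated:
  fixes f h :: "real \<Rightarrow> real"
  assumes "f \<in> borel_measurable borel" "continuous_on UNIV h" "\<And>x. \<bar>f x\<bar> \<le> h x"
  shows "locally_integrable f"
  unfolding locally_integrable_def
proof (intro allI impI)
  fix K :: "real set"
  assume K: "compact K"
  have m: "f \<in> borel_measurable (lebesgue_on K)"
    using assms(1) by (intro measurable_restrict_space1 measurable_completion) simp
  have "integrable lborel (\<lambda>x. indicator K x *\<^sub>R h x)"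
    using K assms(2) by (intro borel_integrable_compact) (auto intro: continuous_on_subset)
  then have "h absolutely_integrable_on K"
    unfolding set_integrable_def
    by (subst integrable_completion) (auto dest: borel_measurable_integrable)
  then have "h integrable_on K"
    by (rule set_lebesgue_integral_eq_integral)
  then show "f absolutely_integrable_on K"
    using K m assms(3)
    by (intro measurable_bounded_by_integrable_imp_absolutely_integrable[of f K h])
       (auto simp: lmeasurable_compact fmeasurableD)
qed

lemma locally_integrable_continuous:
  fixes f :: "real \<Rightarrow> real"
  assumes "continuous_on UNIV f"
  shows "locally_integrable f"
  by (rule locally_integrable_dominated[where h = "\<lambda>x. \<bar>f x\<bar>"])
     (use assms in \<open>auto intro: borel_measurable_continuous_onI continuous_intros\<close>)

text \<open>On its compact support \<open>\<phi>\<close> is bounded and \<open>f\<close> is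
  integrable; elsewhere the product is 0.\<close>

lemma integrable_mult_test_function:
  assumes "locally_integrable f" "test_function \<phi>"
  shows "integrable lebesgue (\<lambda>x. f x * \<phi> x)"
proof -
  define K where "K = closure {x. \<phi> x \<noteq> 0}"
  have K: "compact K" using assms by (simp add: test_function_def K_def)
  have c: "continuous_on S \<phi>" for S
    using assms smooth_continuous_on by (simp add: test_function_def)
  have "(\<lambda>x. \<phi> x * f x) absolutely_integrable_on K"
  proof (rule absolutely_integrable_bounded_measurable_product_real)
    show "\<phi> \<in> borel_measurable (lebesgue_on K)"
      using K c by (intro continuous_imp_measurable_on_sets_lebesgue) (auto simp: lmeasurable_compact fmeasurableD)
    show "K \<in> sets lebesgue" using K by (simp add: lmeasurable_compact fmeasurableD)
    show "bounded (\<phi> ` K)" using K c compact_continuous_image compact_imp_bounded by blast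
    show "f absolutely_integrable_on K" using assms K by (simp add: locally_integrable_def)
  qed
  moreover have "indicator K x *\<^sub>R (\<phi> x * f x) = f x * \<phi> x" for x
    using closure_subset[of "{x. \<phi> x \<noteq> 0}"] by (auto simp: K_def indicator_def)
  ultimately show ?thesis by (simp only: set_integrable_def)
qed

section \<open>Weak derivatives and local Sobolev spaces\<close>

text \<open>Off \<open>S\<close> the classical derivative of \<open>f x * \<phi> x\<close> is
  \<open>f x * deriv \<phi> x + g x * \<phi> x\<close>, and the product is continuous with compact
  support, so this derivative integrates to 0.\<close>

lemma weak_derivativeI:
  assumes "finite S" "continuous_on UNIV f"
    and "\<And>x. x \<notin> S \<Longrightarrow> (f has_real_derivative g x) (at x)"
    and "locally_integrable g"
  shows "weak_derivative f g"
  unfolding weak_derivative_def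
proof (intro conjI allI impI)
  show f: "locally_integrable f" using assms by (simp add: locally_integrable_continuous)
  show "locally_integrable g" by fact
  fix \<phi> assume \<phi>: "test_function \<phi>"
  then have sm: "smooth \<phi>" by (simp add: test_function_def)
  note int = integrable_mult_test_function[OF f test_function_deriv[OF \<phi>]]
    integrable_mult_test_function[OF assms(4) \<phi>]
  have "((\<lambda>x. f x * deriv \<phi> x + g x * \<phi> x) has_integral 0) UNIV"
  proof (rule has_integral_derivative_compact_support[where S = S
        and F = "\<lambda>x. f x * \<phi> x" and K = "closure {x. \<phi> x \<noteq> 0}"])
    show "continuous_on UNIV (\<lambda>x. f x * \<phi> x)"
      using assms smooth_continuous_on[OF sm] by (intro continuous_intros)
    show "((\<lambda>x. f x * \<phi> x) has_real_derivative f x * deriv \<phi> x + g x * \<phi> x) (at x)" if "x \<notin> S" for x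
      by (rule derivative_eq_intros assms(3)[OF that] smoothD[OF sm] refl)+ simp
    show "bounded (closure {x. \<phi> x \<noteq> 0})"
      using \<phi> by (simp add: test_function_def compact_imp_bounded)
  qed (use assms deriv_eq_0_outside_support[of _ \<phi>] closure_subset[of "{x. \<phi> x \<noteq> 0}"] in auto)
  \<comment> \<open>Lebesgue integrability identifies the gauge integral just computed with the
    Lebesgue integral of the definition.\<close>
  moreover have "((\<lambda>x. f x * deriv \<phi> x + g x * \<phi> x) has_integral
      (LINT x|lebesgue. f x * deriv \<phi> x + g x * \<phi> x)) UNIV"
    using int by (intro has_integral_integral_lebesgue) simp
  ultimately have "(LINT x|lebesgue. f x * deriv \<phi> x + g x * \<phi> x) = 0"
    by (rule has_integral_unique[symmetric])
  with int show "(LINT x|lebesgue. f x * deriv \<phi> x) = - (LINT x|lebesgue. g x * \<phi> x)"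
    by simp
qed

text \<open>A continuous \<open>f\<close> without zeros makes \<open>\<bar>f x\<bar> powr q\<close>
  continuous for every real \<open>q\<close>, negative ones included, and \<open>g\<close> has the
  same absolute value.\<close>

lemma W1q_locI:
  assumes "continuous_on UNIV f" "\<And>x. f x \<noteq> 0" "weak_derivative f g"
    and "g \<in> borel_measurable borel" "\<And>x. \<bar>g x\<bar> = \<bar>f x\<bar>"
  shows "f \<in> W1q_loc q"
proof -
  have "continuous_on UNIV (\<lambda>x. \<bar>f x\<bar> powr q)"
    using assms(1,2) by (auto intro!: continuous_intros)
  then have l: "locally_integrable (\<lambda>x. \<bar>f x\<bar> powr q)"
    by (rule locally_integrable_continuous)
  have "g x \<noteq> 0" for x using assms(2,5)[of x] by auto
  then have "f \<in> Lq_loc q" "g \<in> Lq_loc q"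
    using assms l by (auto simp: Lq_loc_def borel_measurable_continuous_onI intro!: measurable_completion)
  with assms(3) show ?thesis by (auto simp: W1q_loc_def)
qed

section \<open>Real powers of signed numbers\<close>

lemma rpow_defined_add_one:
  assumes "x \<noteq> 0" "rpow_defined x r"
  shows "rpow_defined x (r + 1)"
proof -
  have "odd_denominator (r + 1)" if "odd_denominator r"
  proof -
    from that obtain m n :: int where mn: "odd n" "r = of_int m / of_int n"
      by (auto simp: odd_denominator_def)
    then have "r + 1 = of_int (m + n) / of_int n" by (cases "n = 0") (auto simp: field_simps)
    with mn show ?thesis unfolding odd_denominator_def by blast
  qed
  with assms show ?thesis by (auto simp: rpow_defined_def)
qed

lemma rpow_defined_mult_pos:
  assumes "0 < y"
  shows "rpow_defined (x * y) r \<longleftrightarrow> rpow_defined x r"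
  using assms by (auto simp: rpow_defined_def zero_less_mult_iff mult_less_0_iff)

text \<open>A positive factor keeps the sign of the base, hence the branch of \<open>rpow\<close>;
  for exponent 0, \<open>y powr 0 = 1\<close> since \<open>y > 0\<close>.\<close>

lemma rpow_mult_pos:
  assumes "0 < y"
  shows "rpow (x * y) r = rpow x r * y powr r"
proof -
  have "\<bar>x * y\<bar> powr r = \<bar>x\<bar> powr r * y powr r" "x * y < 0 \<longleftrightarrow> x < 0"
    using assms by (auto simp: abs_mult powr_mult mult_less_0_iff)
  then show ?thesis using assms by (simp only: rpow_def) auto
qed

text \<open>For \<open>c < 0\<close> the last two hypotheses give odd denominators to both
  \<open>p\<close> and \<open>1 / p\<close>. Both are then quotients of odd integers, so each power
  preserves the negative sign.\<close>

lemma rpow_inverse_exponent: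
  assumes "p \<noteq> 0" "c \<noteq> 0" "c > 0 \<or> odd_denominator p" "rpow_defined c (1 / p)"
  shows "rpow c (1 / p) \<noteq> 0" "rpow_defined (rpow c (1 / p)) p" "rpow (rpow c (1 / p)) p = c"
proof -
  have "rpow c (1 / p) \<noteq> 0 \<and> rpow_defined (rpow c (1 / p)) p \<and> rpow (rpow c (1 / p)) p = c"
  proof (cases "c > 0")
    case True
    then show ?thesis using assms by (simp add: rpow_def rpow_defined_def powr_powr)
  next
    case False
    then have c: "c < 0" "odd_denominator p" "odd_denominator (1 / p)"
      using assms by (auto simp: rpow_defined_def)
    obtain m n :: int where mn: "odd n" "p = of_int m / of_int n"
      using c by (auto simp: odd_denominator_def)
    obtain m' n' :: int where mn': "odd n'" "1 / p = of_int m' / of_int n'"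
      using c by (auto simp: odd_denominator_def)
    have "n \<noteq> 0" "n' \<noteq> 0" using mn mn' by auto
    moreover have "m \<noteq> 0" using mn assms(1) by auto
    \<comment> \<open>Clearing denominators in \<open>p * (1 / p) = 1\<close>; the left side is odd,
      which forces both numerators to be odd.\<close>
    ultimately have "(of_int (n * n') :: real) = of_int (m * m')"
      using mn(2) mn'(2) assms(1) by (auto simp: divide_eq_eq eq_divide_eq mult.commute)
    then have "n * n' = m * m'" by linarith
    with mn mn' have "odd m" "odd m'" by (metis even_mult_iff)+
    then have o: "\<exists>m n :: int. odd m \<and> odd n \<and> p = of_int m / of_int n"
      "\<exists>m n :: int. odd m \<and> odd n \<and> 1 / p = of_int m / of_int n"
      using mn mn' by blast+
    have a: "rpow c (1 / p) = - (\<bar>c\<bar> powr (1 / p))"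
      using o(2) c assms(1) by (simp add: rpow_def)
    have "rpow x p = - (\<bar>x\<bar> powr p)" if "x < 0" for x
      using o(1) that assms(1) by (simp add: rpow_def)
    from this[of "- (\<bar>c\<bar> powr (1 / p))"] show ?thesis
      unfolding a using c assms(1) by (simp add: rpow_defined_def powr_powr)
  qed
  then show "rpow c (1 / p) \<noteq> 0" "rpow_defined (rpow c (1 / p)) p" "rpow (rpow c (1 / p)) p = c"
    by auto
qed

section \<open>The sign of \<open>z\<close> and its jump at the peak\<close>

text \<open>
  The derivative of \<open>|z|\<close> off the peak. The value at \<open>0\<close> is \<open>1\<close> and not \<open>sgn 0 = 0\<close>, so that the
  square is \<open>1\<close> everywhere.
\<close>

definition side :: "real \<Rightarrow> real" where
  "side z = (if z < 0 then -1 else 1)"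

lemma side_square [simp]: "side z * side z = 1" "(side z)\<^sup>2 = 1"
  by (simp_all add: side_def)

lemma abs_side [simp]: "\<bar>side z\<bar> = 1"
  by (simp add: side_def)

lemma borel_measurable_side [measurable]: "side \<in> borel_measurable borel"
  unfolding side_def by measurable

lemma has_real_derivative_abs_side:
  assumes "z \<noteq> 0"
  shows "(abs has_real_derivative side z) (at z)"
proof (cases "z < 0")
  case True
  show ?thesis
    by (rule has_field_derivative_transform_within_open[of uminus _ _ "{..<0}"])
       (use True in \<open>auto simp: side_def intro!: derivative_eq_intros\<close>)
next
  case False
  show ?thesis
    by (rule has_field_derivative_transform_within_open[of "\<lambda>x. x" _ _ "{0<..}"])
       (use False assms in \<open>auto simp: side_def\<close>)
qed

lemma has_real_derivative_side:
  assumes "z \<noteq> 0"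
  shows "(side has_real_derivative 0) (at z)"
\<comment> \<open>The neighbourhood is the open half-line on the same side of 0 as
  \<open>z\<close>.\<close>
proof (rule has_field_derivative_transform_within_open[of "\<lambda>_. side z" _ _ "{x. 0 < side z * x}"])
  show "open {x. 0 < side z * x}" by (intro open_Collect_less continuous_intros)
qed (use assms in \<open>auto simp: side_def split: if_splits\<close>)

text \<open>The zero of \<open>f\<close> absorbs the jump of \<open>side\<close>; applied to
  \<open>c - V\<close>, with \<open>V\<close> the power \<open>U^p\<close>.\<close>

lemma continuous_on_side_mult:
  assumes "continuous_on UNIV f" "f 0 = 0"
  shows "continuous_on UNIV (\<lambda>z. side z * f z)"
proof -
  have "continuous_on ({z. z \<le> 0} \<union> {z. 0 \<le> z}) (\<lambda>z. if z \<le> 0 then - f z else f z)"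
    by (rule continuous_on_cases)
       (use assms in \<open>auto intro!: continuous_intros closed_Collect_le intro: continuous_on_subset\<close>)
  moreover have "{z::real. z \<le> 0} \<union> {z. 0 \<le> z} = UNIV" by auto
  \<comment> \<open>At 0 the two functions take the values \<open>- f 0\<close> and
    \<open>f 0\<close>, which agree only because \<open>f 0 = 0\<close>.\<close>
  moreover have "(\<lambda>z. if z \<le> 0 then - f z else f z) = (\<lambda>z. side z * f z)"
    using assms(2) by (auto simp: side_def fun_eq_iff)
  ultimately show ?thesis by (simp only:)
qed

section \<open>The peaked profile\<close>

text \<open>Treating the amplitude as any nonzero real solution of \<open>rpow a p = c\<close>
  separates the analysis from the choice of the root.\<close>

lemma weak_profile_peakon:
  fixes a p c :: real
  assumes a: "a \<noteq> 0" "rpow_defined a p" "rpow a p = c"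
  shows "weak_profile p c (\<lambda>z. a * exp (- \<bar>z\<bar>))"
proof -
  define U where "U z = a * exp (- \<bar>z\<bar>)" for z
  define U1 where "U1 z = - side z * U z" for z
  define V where "V z = c * exp (- p * \<bar>z\<bar>)" for z
  have U_nz: "U z \<noteq> 0" for z using a by (simp add: U_def)
  have U_pow: "rpow_defined (U z) p" for z
    using a by (simp add: U_def rpow_defined_mult_pos)
  have rpow_U: "rpow (U z) p = V z" for z
    using a by (simp add: U_def V_def rpow_mult_pos powr_def)
  have rpow_U1: "rpow (U z) (p + 1) = U z * V z" for z
    using rpow_plus_one[OF U_nz rpow_defined_add_one[OF U_nz U_pow]] by (simp add: rpow_U)
  \<comment> \<open>This removes the term with exponent \<open>p - 1\<close> from the integrand, at
    the peak as well.\<close>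
  have U1_sq: "(U1 z)\<^sup>2 = (U z)\<^sup>2" for z by (simp add: U1_def power_mult_distrib)
  have cont [continuous_intros]: "continuous_on S U" "continuous_on S V" for S
    unfolding U_def V_def by (intro continuous_intros)+
  have [measurable]: "U \<in> borel_measurable borel" "V \<in> borel_measurable borel"
    using cont by (auto intro: borel_measurable_continuous_onI)
  have dU: "(U has_real_derivative U1 z) (at z)" if "z \<noteq> 0" for z
    unfolding U_def U1_def
    by (rule derivative_eq_intros has_real_derivative_abs_side[OF that] refl)+ simp
  have dV: "(V has_real_derivative - p * side z * V z) (at z)" if "z \<noteq> 0" for z
    unfolding V_def
    by (rule derivative_eq_intros has_real_derivative_abs_side[OF that] refl)+ simp
  have wU: "weak_derivative U U1"
  proof (rule weak_derivativeI[of "{0}"])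
    show "locally_integrable U1"
      by (rule locally_integrable_dominated[where h = "\<lambda>z. \<bar>U z\<bar>"])
         (auto simp: U1_def[abs_def] abs_mult intro!: continuous_intros)
  qed (auto intro!: continuous_intros dU)
  have weak: "\<exists>D. weak_derivative (\<lambda>z. \<phi> z * rpow (U z) p) D \<and>
      integrable lebesgue (weak_integrand p c \<phi> U U1 D) \<and>
      (LINT z|lebesgue. weak_integrand p c \<phi> U U1 D z) = 0" if \<phi>: "test_function \<phi>" for \<phi>
  proof -
    have sm: "smooth \<phi>" using \<phi> by (simp add: test_function_def)
    have \<phi>_cont [continuous_intros]: "continuous_on S \<phi>" "continuous_on S (deriv \<phi>)" for S
      using sm smooth_deriv smooth_continuous_on by blast+
    have [measurable]: "\<phi> \<in> borel_measurable borel" "deriv \<phi> \<in> borel_measurable borel"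
      using \<phi>_cont by (auto intro: borel_measurable_continuous_onI)
    \<comment> \<open>The product rule for \<open>\<phi> z * V z\<close> off the peak.\<close>
    define D where "D z = deriv \<phi> z * V z - p * side z * \<phi> z * V z" for z
    define I where "I = weak_integrand p c \<phi> U U1 D"
    have wD: "weak_derivative (\<lambda>z. \<phi> z * rpow (U z) p) D"
      unfolding rpow_U
    proof (rule weak_derivativeI[of "{0}"])
      show "continuous_on UNIV (\<lambda>z. \<phi> z * V z)" by (intro continuous_intros)
      show "((\<lambda>z. \<phi> z * V z) has_real_derivative D z) (at z)" if "z \<notin> {0}" for z
        unfolding D_def by (rule derivative_eq_intros smoothD[OF sm] dV refl)+ (use that in auto)
      show "locally_integrable D"
      proof (rule locally_integrable_dominated)
        show "D \<in> borel_measurable borel" unfolding D_def[abs_def] by measurable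
        show "continuous_on UNIV (\<lambda>z. \<bar>deriv \<phi> z * V z\<bar> + \<bar>p * \<phi> z * V z\<bar>)"
          by (intro continuous_intros)
        show "\<bar>D z\<bar> \<le> \<bar>deriv \<phi> z * V z\<bar> + \<bar>p * \<phi> z * V z\<bar>" for z
          unfolding D_def by (rule order_trans[OF abs_triangle_ineq4]) (simp add: abs_mult)
      qed
    qed simp
    \<comment> \<open>Grouping by \<open>\<phi>\<close> and \<open>deriv \<phi>\<close> leaves
      continuous coefficients: \<open>side\<close> survives only next to \<open>c - V z\<close>,
      which vanishes at 0. Integrability follows.\<close>
    have I_eq: "I z = ((p + 1) * V z - c) * U z * \<phi> z + U z * (side z * (c - V z)) * deriv \<phi> z" for z
    proof -
      have "I z = - c * (\<phi> z * U z + deriv \<phi> z * U1 z) + \<phi> z * (U z * V z) + U1 z * D z"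
        by (simp add: I_def weak_integrand_def U1_sq rpow_U1)
      also have "U1 z * D z = - side z * U z * deriv \<phi> z * V z + p * (side z * side z) * U z * \<phi> z * V z"
        by (simp only: U1_def D_def) algebra
      finally show ?thesis by (simp add: U1_def algebra_simps)
    qed
    have cG: "continuous_on UNIV (\<lambda>z. side z * (c - V z))"
      by (rule continuous_on_side_mult) (auto intro!: continuous_intros simp: V_def)
    have I_int: "integrable lebesgue I"
      unfolding I_eq[abs_def]
      by (intro Bochner_Integration.integrable_add integrable_mult_test_function
            locally_integrable_continuous test_function_deriv \<phi> continuous_intros cG)
    have "(I has_integral 0) UNIV"
    proof (rule has_integral_derivative_compact_support[where S = "{0}"
          and F = "\<lambda>z. \<phi> z * U z * (side z * (c - V z))" and K = "closure {x. \<phi> x \<noteq> 0}"])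
      show "continuous_on UNIV (\<lambda>z. \<phi> z * U z * (side z * (c - V z)))"
        by (intro continuous_intros cG)
      show "((\<lambda>z. \<phi> z * U z * (side z * (c - V z))) has_real_derivative I z) (at z)" if "z \<notin> {0}" for z
      proof -
        have z: "z \<noteq> 0" using that by simp
        \<comment> \<open>Off the peak \<open>side\<close> is locally constant, and the factor
          \<open>side z\<close> in the derivative of \<open>V\<close> squares to 1.\<close>
        have "((\<lambda>z. side z * (c - V z)) has_real_derivative p * V z) (at z)"
          by (rule derivative_eq_intros has_real_derivative_side[OF z] dV[OF z] refl)+
             (simp add: side_def)
        note dH = this
        have "((\<lambda>z. \<phi> z * U z) has_real_derivative deriv \<phi> z * U z + \<phi> z * U1 z) (at z)"
          by (rule derivative_eq_intros smoothD[OF sm] dU[OF z] refl)+ simp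
        from DERIV_mult[OF this dH]
        have "((\<lambda>z. \<phi> z * U z * (side z * (c - V z))) has_real_derivative
            (deriv \<phi> z * U z + \<phi> z * U1 z) * (side z * (c - V z)) + p * V z * (\<phi> z * U z)) (at z)" .
        moreover have "(deriv \<phi> z * U z + \<phi> z * U1 z) * (side z * (c - V z)) + p * V z * (\<phi> z * U z) = I z"
          unfolding I_eq by (simp add: U1_def side_def algebra_simps)
        ultimately show ?thesis by simp
      qed
      show "bounded (closure {x. \<phi> x \<noteq> 0})"
        using \<phi> by (simp add: test_function_def compact_imp_bounded)
    qed (use deriv_eq_0_outside_support[of _ \<phi>] closure_subset[of "{x. \<phi> x \<noteq> 0}"] in
          \<open>auto simp: I_eq\<close>)
    moreover have "(I has_integral (LINT z|lebesgue. I z)) UNIV"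
      using I_int by (rule has_integral_integral_lebesgue)
    ultimately have "(LINT z|lebesgue. I z) = 0"
      by (rule has_integral_unique[symmetric])
    with wD I_int show ?thesis
      unfolding I_def by blast
  qed
  have "AE z in lebesgue. rpow_defined (U z) (p - 1)"
    using rpow_defined_diff_one[OF U_nz U_pow] by simp
  moreover have "U \<in> W1q_loc (p + 1)"
    by (rule W1q_locI[OF _ _ wU]) (auto simp: U_nz U1_def[abs_def] abs_mult intro!: cont)
  ultimately have "weak_profile p c U"
    unfolding weak_profile_def using wU weak by blast
  then show ?thesis by (simp add: U_def[abs_def])
qed

theorem proposition3p2:
  fixes p c :: real
  assumes "p \<noteq> 0"
    and "c \<noteq> 0"
    and "c > 0 \<or> odd_denominator p"
    and "rpow_defined c (1 / p)"
  shows "weak_travelling_wave_solution p c (\<lambda>t x. rpow c (1 / p) * exp (- \<bar>x + c * t\<bar>))"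
  unfolding weak_travelling_wave_solution_def
  using weak_profile_peakon[OF rpow_inverse_exponent[OF assms]]
  by (intro exI[of _ "\<lambda>z. rpow c (1 / p) * exp (- \<bar>z\<bar>)"]) simp

end
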